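(* For every statement $S$ of the language Rec (interpreted relative to a fixed well-formed procedure table $T$), the denotational finite-trace semantics coincides with the finite-trace semantics induced by the structural operational semantics: $\mathcal{S}_{tr}[\![S]\!] = \mathcal{S}_{sos}[\![S]\!]$.
   Context: Rec programs: a Rec program is a pair $\langle S,T\rangle$ where $S$ is a statement generated by $S ::= \mathbf{skip} \mid x := a \mid S_1;S_2 \mid \mathbf{if}\ b\ \mathbf{then}\ S_1\ \mathbf{else}\ S_2 \mid m()$, and $T$ (the procedure table) is a finite list of declarations $m\,\{S_m\}$ of parameterless procedures; procedure names are unique and only declared procedures are called. Here $a$ ranges over side-effect-free arithmetic expressions and $b$ over side-effect-free Boolean expressions; all variables are global and range over $\mathbb{Z}$. $\mathbf{State}$ is the set of maps $s:\mathit{Var}\to\mathbb{Z}$; $\mathcal{A}[\![a]\!](s)\in\mathbb{Z}$ and $\mathcal{B}[\![b]\!](s)\in\{\mathbf{tt},\mathbf{ff}\}$ denote evaluation in $s$; $s[x\mapsto v]$ is state update. $\mathbf{State}^+$ is the set of nonempty finite sequences of states $s_0\cdot s_1\cdots s_n$. SOS: configurations are pairs $\langle S,s\rangle$ or final states $s$. Transitions: $\langle\mathbf{skip},s\rangle\Rightarrow s$; $\langle x:=a,s\rangle\Rightarrow s[x\mapsto\mathcal{A}[\![a]\!](s)]$; if $\langle S_1,s\rangle\Rightarrow s'$ then $\langle S_1;S_2,s\rangle\Rightarrow\langle S_2,s'\rangle$; if $\langle S_1,s\rangle\Rightarrow\langle S_1',s'\rangle$ then $\langle S_1;S_2,s\rangle\Rightarrow\langle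 S_1';S_2,s'\rangle$; $\langle \mathbf{if}\ b\ \mathbf{then}\ S_1\ \mathbf{else}\ S_2,s\rangle\Rightarrow\langle S_1,s\rangle$ if $\mathcal{B}[\![b]\!](s)=\mathbf{tt}$, and $\Rightarrow\langle S_2,s\rangle$ if $\mathcal{B}[\![b]\!](s)=\mathbf{ff}$; $\langle m(),s\rangle\Rightarrow\langle S_m,s\rangle$ if $m\,\{S_m\}$ is in $T$. The induced semantics $\mathcal{S}_{sos}[\![S]\!]$ is the set of sequences $s_0\cdots s_n$ ($n\ge 1$) for which there are statements $S_0=S,S_1,\dots,S_{n-1}$ with $\langle S_i,s_i\rangle\Rightarrow\langle S_{i+1},s_{i+1}\rangle$ for $0\le i\le n-2$ and $\langle S_{n-1},s_{n-1}\rangle\Rightarrow s_n$. Denotational semantics: for $A,B\subseteq\mathbf{State}^+$ let $A|_b=\{s\cdot\sigma\in A:\mathcal{B}[\![b]\!](s)=\mathbf{tt}\}$, $\sharp A=\{s\cdot s\cdot\sigma: s\cdot\sigma\in A\}$, and $A\frown B=\{\sigma_A\cdot s\cdot\sigma_B:\sigma_A\cdot s\in A,\ s\cdot\sigma_B\in B\}$ ($\sigma_A,\sigma_B$ possibly empty). Let $M=\{m_1,\dots,m_n\}$ be the procedures declared in $T$ as $m_i\,\{S_i\}$. For $\rho:M\to 2^{\mathbf{State}^+}$ define $\mathcal{S}_{tr}[\![\mathbf{skip}]\!]_\rho=\{s\cdot s\}$, $\mathcal{S}_{tr}[\![x:=a]\!]_\rho=\{s\cdot s[x\mapsto\mathcal{A}[\![a]\!](s)]\}$,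 $\mathcal{S}_{tr}[\![S_1;S_2]\!]_\rho=\mathcal{S}_{tr}[\![S_1]\!]_\rho\frown\mathcal{S}_{tr}[\![S_2]\!]_\rho$, $\mathcal{S}_{tr}[\![\mathbf{if}\ b\ \mathbf{then}\ S_1\ \mathbf{else}\ S_2]\!]_\rho=(\sharp\mathcal{S}_{tr}[\![S_1]\!]_\rho)|_b\cup(\sharp\mathcal{S}_{tr}[\![S_2]\!]_\rho)|_{\neg b}$, $\mathcal{S}_{tr}[\![m_i()]\!]_\rho=\rho(m_i)$ (all with $s$ ranging over $\mathbf{State}$). Let $H(\rho)=(\sharp\mathcal{S}_{tr}[\![S_1]\!]_\rho,\dots,\sharp\mathcal{S}_{tr}[\![S_n]\!]_\rho)$, let $\rho_0$ be its least fixed point w.r.t. pointwise inclusion, and $\mathcal{S}_{tr}[\![S]\!]=\mathcal{S}_{tr}[\![S]\!]_{\rho_0}$. *)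

theory Defs
  imports Main
begin

text \<open>
  The grammar of side-effect-free expressions is left open: statements are generic in the
  types \<open>'a\<close> and \<open>'b\<close> of arithmetic and Boolean expressions, and the semantics takes the
  evaluation functions \<open>\<A>\<close> and \<open>\<B>\<close> as parameters. Variables and procedure names are also
  arbitrary types \<open>'v\<close> and \<open>'p\<close>.
\<close>

type_synonym 'v state = "'v \<Rightarrow> int"
type_synonym 'v trace = "'v state list"
type_synonym ('v, 'a) aeval = "'a \<Rightarrow> 'v state \<Rightarrow> int"
type_synonym ('v, 'b) beval = "'b \<Rightarrow> 'v state \<Rightarrow> bool"

datatype ('v, 'a, 'b, 'p) stmt =
    Skip
  | Assign 'v 'a
  | Seq "('v, 'a, 'b, 'p) stmt" "('v, 'a, 'b, 'p) stmt"
  | Cond 'b "('v, 'a, 'b, 'p) stmt" "('v, 'a, 'b, 'p) stmt"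
  | Call 'p

type_synonym ('v, 'a, 'b, 'p) table = "('p \<times> ('v, 'a, 'b, 'p) stmt) list"

primrec calls :: "('v, 'a, 'b, 'p) stmt \<Rightarrow> 'p set" where
  "calls Skip = {}"
| "calls (Assign x a) = {}"
| "calls (Seq S1 S2) = calls S1 \<union> calls S2"
| "calls (Cond b S1 S2) = calls S1 \<union> calls S2"
| "calls (Call m) = {m}"

definition declared :: "('v, 'a, 'b, 'p) table \<Rightarrow> 'p set" where
  "declared T = fst ` set T"

definition wf_table :: "('v, 'a, 'b, 'p) table \<Rightarrow> bool" where
  "wf_table T \<longleftrightarrow> distinct (map fst T) \<and> (\<forall>(m, S) \<in> set T. calls S \<subseteq> declared T)"

definition wf_program :: "('v, 'a, 'b, 'p) stmt \<Rightarrow> ('v, 'a, 'b, 'p) table \<Rightarrow> bool" where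
  "wf_program S T \<longleftrightarrow> wf_table T \<and> calls S \<subseteq> declared T"


section \<open>Structural operational semantics\<close>

datatype ('v, 'a, 'b, 'p) config =
    Run "('v, 'a, 'b, 'p) stmt" "'v state"
  | Final "'v state"

inductive sos_step ::
  "('v, 'a) aeval \<Rightarrow> ('v, 'b) beval \<Rightarrow> ('v, 'a, 'b, 'p) table \<Rightarrow>
   ('v, 'a, 'b, 'p) config \<Rightarrow> ('v, 'a, 'b, 'p) config \<Rightarrow> bool"
  for \<A> \<B> T where
  skip: "sos_step \<A> \<B> T (Run Skip s) (Final s)"
| assign: "sos_step \<A> \<B> T (Run (Assign x a) s) (Final (s(x := \<A> a s)))"
| seq_final: "sos_step \<A> \<B> T (Run S1 s) (Final s') \<Longrightarrow>
    sos_step \<A> \<B> T (Run (Seq S1 S2) s) (Run S2 s')"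
| seq_run: "sos_step \<A> \<B> T (Run S1 s) (Run S1' s') \<Longrightarrow>
    sos_step \<A> \<B> T (Run (Seq S1 S2) s) (Run (Seq S1' S2) s')"
| cond_true: "\<B> b s \<Longrightarrow> sos_step \<A> \<B> T (Run (Cond b S1 S2) s) (Run S1 s)"
| cond_false: "\<not> \<B> b s \<Longrightarrow> sos_step \<A> \<B> T (Run (Cond b S1 S2) s) (Run S2 s)"
| call: "(m, S) \<in> set T \<Longrightarrow> sos_step \<A> \<B> T (Run (Call m) s) (Run S s)"

definition sem_sos ::
  "('v, 'a) aeval \<Rightarrow> ('v, 'b) beval \<Rightarrow> ('v, 'a, 'b, 'p) table \<Rightarrow>
   ('v, 'a, 'b, 'p) stmt \<Rightarrow> 'v trace set" where
  "sem_sos \<A> \<B> T S =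
    {ss. \<exists>n Ss. 1 \<le> n \<and> length ss = n + 1 \<and> length Ss = n \<and> Ss ! 0 = S \<and>
       (\<forall>i. i + 2 \<le> n \<longrightarrow>
          sos_step \<A> \<B> T (Run (Ss ! i) (ss ! i)) (Run (Ss ! (i + 1)) (ss ! (i + 1)))) \<and>
       sos_step \<A> \<B> T (Run (Ss ! (n - 1)) (ss ! (n - 1))) (Final (ss ! n))}"


section \<open>Denotational semantics\<close>

definition restrict_tr :: "'v trace set \<Rightarrow> ('v state \<Rightarrow> bool) \<Rightarrow> 'v trace set" where
  "restrict_tr A P = {s # \<sigma> | s \<sigma>. s # \<sigma> \<in> A \<and> P s}"

definition sharp :: "'v trace set \<Rightarrow> 'v trace set" where
  "sharp A = {s # s # \<sigma> | s \<sigma>. s # \<sigma> \<in> A}"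

definition chop :: "'v trace set \<Rightarrow> 'v trace set \<Rightarrow> 'v trace set" where
  "chop A B = {\<sigma>A @ [s] @ \<sigma>B | \<sigma>A s \<sigma>B. \<sigma>A @ [s] \<in> A \<and> [s] @ \<sigma>B \<in> B}"

primrec sem_tr_env ::
  "('v, 'a) aeval \<Rightarrow> ('v, 'b) beval \<Rightarrow> ('p \<Rightarrow> 'v trace set) \<Rightarrow>
   ('v, 'a, 'b, 'p) stmt \<Rightarrow> 'v trace set" where
  "sem_tr_env \<A> \<B> \<rho> Skip = {[s, s] | s. True}"
| "sem_tr_env \<A> \<B> \<rho> (Assign x a) = {[s, s(x := \<A> a s)] | s. True}"
| "sem_tr_env \<A> \<B> \<rho> (Seq S1 S2) = chop (sem_tr_env \<A> \<B> \<rho> S1) (sem_tr_env \<A> \<B> \<rho> S2)"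
| "sem_tr_env \<A> \<B> \<rho> (Cond b S1 S2) =
     restrict_tr (sharp (sem_tr_env \<A> \<B> \<rho> S1)) (\<B> b) \<union>
     restrict_tr (sharp (sem_tr_env \<A> \<B> \<rho> S2)) (\<lambda>s. \<not> \<B> b s)"
| "sem_tr_env \<A> \<B> \<rho> (Call m) = \<rho> m"

text \<open>
  Environments are total functions; outside the declared procedures \<open>proc_op\<close> returns the
  empty set, which does not affect the components at declared procedures of a well-formed
  table. Environments may also contain the empty list, which is not a trace; the least
  fixed point does not (lemma \<open>proc_env_nonempty\<close>).
\<close>

definition proc_op ::
  "('v, 'a) aeval \<Rightarrow> ('v, 'b) beval \<Rightarrow> ('v, 'a, 'b, 'p) table \<Rightarrow>
   ('p \<Rightarrow> 'v trace set) \<Rightarrow> ('p \<Rightarrow> 'v trace set)" where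
  "proc_op \<A> \<B> T \<rho> =
    (\<lambda>m. case map_of T m of None \<Rightarrow> {} | Some S \<Rightarrow> sharp (sem_tr_env \<A> \<B> \<rho> S))"

definition proc_env ::
  "('v, 'a) aeval \<Rightarrow> ('v, 'b) beval \<Rightarrow> ('v, 'a, 'b, 'p) table \<Rightarrow> 'p \<Rightarrow> 'v trace set" where
  "proc_env \<A> \<B> T = lfp (proc_op \<A> \<B> T)"

definition sem_tr ::
  "('v, 'a) aeval \<Rightarrow> ('v, 'b) beval \<Rightarrow> ('v, 'a, 'b, 'p) table \<Rightarrow>
   ('v, 'a, 'b, 'p) stmt \<Rightarrow> 'v trace set" where
  "sem_tr \<A> \<B> T S = sem_tr_env \<A> \<B> (proc_env \<A> \<B> T) S"

lemma restrict_tr_mono: "A \<subseteq> A' \<Longrightarrow> restrict_tr A P \<subseteq> restrict_tr A' P"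
  unfolding restrict_tr_def by blast

lemma sharp_mono: "A \<subseteq> A' \<Longrightarrow> sharp A \<subseteq> sharp A'"
  unfolding sharp_def by blast

lemma chop_mono: "A \<subseteq> A' \<Longrightarrow> B \<subseteq> B' \<Longrightarrow> chop A B \<subseteq> chop A' B'"
  unfolding chop_def by blast

lemma sem_tr_env_mono: "\<rho> \<le> \<rho>' \<Longrightarrow> sem_tr_env \<A> \<B> \<rho> S \<subseteq> sem_tr_env \<A> \<B> \<rho>' S"
proof (induction S)
  case (Seq S1 S2)
  then show ?case by (simp add: chop_mono)
next
  case (Cond b S1 S2)
  then show ?case
    unfolding sem_tr_env.simps by (intro Un_mono restrict_tr_mono sharp_mono) simp_all
next
  case (Call m)
  then show ?case by (simp add: le_fun_def)
qed simp_all

lemma proc_op_mono: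
  fixes T :: "('v, 'a, 'b, 'p) table"
  shows "mono (proc_op \<A> \<B> T)"
proof (rule monoI)
  fix \<rho> \<rho>' :: "'p \<Rightarrow> 'v trace set"
  assume "\<rho> \<le> \<rho>'"
  then show "proc_op \<A> \<B> T \<rho> \<le> proc_op \<A> \<B> T \<rho>'"
    by (simp add: proc_op_def le_funI sharp_mono sem_tr_env_mono split: option.split)
qed

lemma proc_env_fixpoint: "proc_op \<A> \<B> T (proc_env \<A> \<B> T) = proc_env \<A> \<B> T"
  unfolding proc_env_def by (rule lfp_fixpoint[OF proc_op_mono])

lemma proc_env_least: "proc_op \<A> \<B> T \<rho> = \<rho> \<Longrightarrow> proc_env \<A> \<B> T \<le> \<rho>"
  unfolding proc_env_def by (rule lfp_lowerbound) simp

lemma proc_env_nonempty: "[] \<notin> proc_env \<A> \<B> T m"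
  by (subst proc_env_fixpoint[symmetric])
    (auto simp: proc_op_def sharp_def split: option.split)

end

(* Idea: the SOS traces of procedure calls form a pre-fixed point of proc_op, because SOS runs
   compose along chop and sharp; hence they contain the least fixed point. Conversely, prepending
   an SOS step to a denotational trace of the residual statement yields a denotational trace of
   the original statement, so induction on the length of a run suffices and no run of a
   sequential composition ever has to be split. *)
theory Submission
  imports Defs
begin

text \<open>Replaces the indexed runs of \<open>sem_sos\<close> by an object that supports rule
  induction. Writing the tail as \<open>s' # \<sigma>\<close> forces it to start in the state
  reached by the step.\<close>

inductive sos_run ::
  "('v, 'a) aeval \<Rightarrow> ('v, 'b) beval \<Rightarrow> ('v, 'a, 'b, 'p) table \<Rightarrow>
   ('v, 'a, 'b, 'p) stmt \<Rightarrow> 'v trace \<Rightarrow> bool"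
  for \<A> \<B> T where
  final: "sos_step \<A> \<B> T (Run S s) (Final s') \<Longrightarrow> sos_run \<A> \<B> T S [s, s']"
| step: "sos_step \<A> \<B> T (Run S s) (Run S' s') \<Longrightarrow> sos_run \<A> \<B> T S' (s' # \<sigma>) \<Longrightarrow>
    sos_run \<A> \<B> T S (s # s' # \<sigma>)"

lemma sos_run_of_steps:
  assumes "length ss = Suc (Suc n)" "length Ss = Suc n"
    and "\<forall>i<n. sos_step \<A> \<B> T (Run (Ss ! i) (ss ! i)) (Run (Ss ! Suc i) (ss ! Suc i))"
    and "sos_step \<A> \<B> T (Run (Ss ! n) (ss ! n)) (Final (ss ! Suc n))"
  shows "sos_run \<A> \<B> T (Ss ! 0) ss"
  using assms
proof (induction n arbitrary: ss Ss)
  case 0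
  then obtain s s' where "ss = [s, s']"
    by (auto simp: length_Suc_conv)
  with 0 show ?case
    by (auto intro: sos_run.final)
next
  case (Suc n)
  obtain s s' \<sigma> where ss: "ss = s # s' # \<sigma>"
    using Suc.prems(1) by (auto simp: length_Suc_conv)
  obtain S S' Ss' where Ss: "Ss = S # S' # Ss'"
    using Suc.prems(2) by (auto simp: length_Suc_conv)
  have "sos_run \<A> \<B> T ((S' # Ss') ! 0) (s' # \<sigma>)"
    using Suc.prems unfolding ss Ss by (intro Suc.IH) auto
  moreover have "sos_step \<A> \<B> T (Run S s) (Run S' s')"
    using Suc.prems(3)[rule_format, of 0] by (simp add: ss Ss)
  ultimately show ?case
    by (simp add: ss Ss sos_run.step)
qed

lemma steps_of_sos_run:
  assumes "sos_run \<A> \<B> T S ss"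
  shows "\<exists>n Ss. length ss = Suc (Suc n) \<and> length Ss = Suc n \<and> Ss ! 0 = S \<and>
    (\<forall>i<n. sos_step \<A> \<B> T (Run (Ss ! i) (ss ! i)) (Run (Ss ! Suc i) (ss ! Suc i))) \<and>
    sos_step \<A> \<B> T (Run (Ss ! n) (ss ! n)) (Final (ss ! Suc n))"
  using assms
proof induction
  case (final S s s')
  then show ?case
    by (intro exI[of _ 0] exI[of _ "[S]"]) simp
next
  case (step S s S' s' \<sigma>)
  then obtain n Ss where "length (s' # \<sigma>) = Suc (Suc n)" "length Ss = Suc n" "Ss ! 0 = S'"
    "\<forall>i<n. sos_step \<A> \<B> T (Run (Ss ! i) ((s' # \<sigma>) ! i)) (Run (Ss ! Suc i) ((s' # \<sigma>) ! Suc i))"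
    "sos_step \<A> \<B> T (Run (Ss ! n) ((s' # \<sigma>) ! n)) (Final ((s' # \<sigma>) ! Suc n))"
    by blast
  with step.hyps(1) show ?case
    by (intro exI[of _ "Suc n"] exI[of _ "S # Ss"]) (auto simp: less_Suc_eq_0_disj)
qed

lemma sem_sos_eq_sos_run: "sem_sos \<A> \<B> T S = {ss. sos_run \<A> \<B> T S ss}"
proof (intro equalityI subsetI)
  fix ss
  assume "ss \<in> sem_sos \<A> \<B> T S"
  then obtain n Ss where n: "1 \<le> n" "length ss = n + 1" "length Ss = n" "Ss ! 0 = S"
    "\<forall>i. i + 2 \<le> n \<longrightarrow>
       sos_step \<A> \<B> T (Run (Ss ! i) (ss ! i)) (Run (Ss ! (i + 1)) (ss ! (i + 1)))"
    "sos_step \<A> \<B> T (Run (Ss ! (n - 1)) (ss ! (n - 1))) (Final (ss ! n))"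
    unfolding sem_sos_def by blast
  \<comment> \<open>\<open>sem_sos\<close> counts all \<open>n\<close> steps; \<open>k\<close>
    counts only those before the final one.\<close>
  from n(1) obtain k where "n = Suc k"
    by (cases n) auto
  with n show "ss \<in> {ss. sos_run \<A> \<B> T S ss}"
    using sos_run_of_steps[of ss k Ss] by auto
next
  fix ss
  assume "ss \<in> {ss. sos_run \<A> \<B> T S ss}"
  then obtain n Ss where n: "length ss = Suc (Suc n)" "length Ss = Suc n" "Ss ! 0 = S"
    "\<forall>i<n. sos_step \<A> \<B> T (Run (Ss ! i) (ss ! i)) (Run (Ss ! Suc i) (ss ! Suc i))"
    "sos_step \<A> \<B> T (Run (Ss ! n) (ss ! n)) (Final (ss ! Suc n))"
    using steps_of_sos_run by blast
  then show "ss \<in> sem_sos \<A> \<B> T S"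
    unfolding sem_sos_def by (intro CollectI exI[of _ "Suc n"] exI[of _ Ss]) auto
qed

text \<open>Each step of the first run is lifted by \<open>seq_run\<close>, its last one by
  \<open>seq_final\<close>. The shared state \<open>t\<close> occurs only once, as in
  \<open>chop\<close>.\<close>

lemma sos_run_Seq:
  assumes "sos_run \<A> \<B> T S1 \<sigma>" "\<sigma> = \<sigma>A @ [t]" "sos_run \<A> \<B> T S2 (t # \<sigma>B)"
  shows "sos_run \<A> \<B> T (Seq S1 S2) (\<sigma>A @ t # \<sigma>B)"
  using assms
proof (induction arbitrary: \<sigma>A)
  case (final S1 s s')
  then have "\<sigma>A = [s]" "t = s'"
    by (auto simp: Cons_eq_append_conv)
  with final show ?case
    by (auto intro: sos_run.step sos_step.seq_final)
next
  case (step S1 s S1' s' \<sigma>)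
  then obtain \<sigma>A' where \<sigma>A: "\<sigma>A = s # \<sigma>A'" "s' # \<sigma> = \<sigma>A' @ [t]"
    by (auto simp: Cons_eq_append_conv)
  \<comment> \<open>\<open>sos_run.step\<close> applies only to a tail whose head \<open>s'\<close>
    is visible.\<close>
  then obtain \<tau> where \<tau>: "\<sigma>A' @ t # \<sigma>B = s' # \<tau>"
    by (cases \<sigma>A') auto
  show ?case
    using step.IH[OF \<sigma>A(2) step.prems(2)] step.hyps(1)
    by (auto simp: \<sigma>A(1) \<tau> intro: sos_run.step sos_step.seq_run)
qed

text \<open>Interpreting each call by its own SOS runs makes the \<open>Call\<close> case trivial,
  so structural induction suffices and no procedure body is unfolded.\<close>

lemma sem_tr_env_sos_run_subset:
  "sem_tr_env \<A> \<B> (\<lambda>m. {ss. sos_run \<A> \<B> T (Call m) ss}) S \<subseteq> {ss. sos_run \<A> \<B> T S ss}"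
proof (induction S)
  case (Seq S1 S2)
  then show ?case
    by (auto simp: chop_def intro!: sos_run_Seq)
next
  case (Cond b S1 S2)
  then show ?case
    unfolding sem_tr_env.simps restrict_tr_def sharp_def
    by (blast intro: sos_run.step[OF sos_step.cond_true] sos_run.step[OF sos_step.cond_false])
qed (auto intro: sos_run.final sos_step.skip sos_step.assign)

text \<open>A call step keeps the state, and this is the repetition that \<open>sharp\<close> adds;
  hence the right-hand side is a pre-fixed point of \<open>proc_op\<close>.\<close>

lemma proc_env_subset_sos_run: "proc_env \<A> \<B> T \<le> (\<lambda>m. {ss. sos_run \<A> \<B> T (Call m) ss})"
  (is "_ \<le> ?\<rho>")
  unfolding proc_env_def
proof (intro lfp_lowerbound le_funI subsetI)
  fix m \<sigma>
  assume "\<sigma> \<in> proc_op \<A> \<B> T ?\<rho> m"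
  then obtain S where "map_of T m = Some S" "\<sigma> \<in> sharp (sem_tr_env \<A> \<B> ?\<rho> S)"
    by (auto simp: proc_op_def split: option.splits)
  then show "\<sigma> \<in> ?\<rho> m"
    using sem_tr_env_sos_run_subset[of \<A> \<B> T S]
    by (auto simp: sharp_def intro: sos_run.step[OF sos_step.call, OF map_of_SomeD])
qed

text \<open>The SOS rule looks procedures up by membership in \<open>T\<close>,
  \<open>proc_op\<close> by \<open>map_of\<close>; distinct names make the two agree.\<close>

lemma sem_tr_Call:
  assumes "distinct (map fst T)" "(m, S) \<in> set T"
  shows "sem_tr \<A> \<B> T (Call m) = sharp (sem_tr \<A> \<B> T S)"
proof -
  have "proc_env \<A> \<B> T m = proc_op \<A> \<B> T (proc_env \<A> \<B> T) m"
    by (simp add: proc_env_fixpoint)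
  with assms show ?thesis
    by (simp add: sem_tr_def proc_op_def)
qed

lemma sem_tr_final_step:
  "sos_step \<A> \<B> T (Run S s) (Final s') \<Longrightarrow> [s, s'] \<in> sem_tr \<A> \<B> T S"
  by (erule sos_step.cases) (auto simp: sem_tr_def)

text \<open>Backward closure under one step, by induction on its derivation. \<open>\<sigma>\<close>
  is arbitrary because \<open>seq_run\<close> needs the hypothesis for the part of the trace that
  belongs to \<open>S1'\<close>.\<close>

lemma sem_tr_run_step:
  assumes "sos_step \<A> \<B> T (Run S s) (Run S' s')" "s' # \<sigma> \<in> sem_tr \<A> \<B> T S'"
    and "distinct (map fst T)"
  shows "s # s' # \<sigma> \<in> sem_tr \<A> \<B> T S"
  using assms
proof (induction "Run S s" "Run S' s'" arbitrary: S S' \<sigma> rule: sos_step.induct)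
  case (seq_final S1 S2)
  then have "[s] @ [s'] \<in> sem_tr \<A> \<B> T S1" "[s'] @ \<sigma> \<in> sem_tr \<A> \<B> T S2"
    by (simp_all add: sem_tr_final_step)
  then have "[s] @ [s'] @ \<sigma> \<in> chop (sem_tr \<A> \<B> T S1) (sem_tr \<A> \<B> T S2)"
    unfolding chop_def by blast
  then show ?case
    by (simp add: sem_tr_def)
next
  case (seq_run S1 S1' S2)
  then obtain \<sigma>A t \<sigma>B where \<sigma>: "s' # \<sigma> = \<sigma>A @ [t] @ \<sigma>B"
    "\<sigma>A @ [t] \<in> sem_tr \<A> \<B> T S1'" "[t] @ \<sigma>B \<in> sem_tr \<A> \<B> T S2"
    by (auto simp: sem_tr_def chop_def)
  \<comment> \<open>The part produced by \<open>S1'\<close> starts in \<open>s'\<close> even if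
    \<open>\<sigma>A\<close> is empty, since then \<open>t\<close> is \<open>s'\<close>.\<close>
  then obtain \<tau> where \<tau>: "\<sigma>A @ [t] = s' # \<tau>"
    by (cases \<sigma>A) auto
  then have "(s # \<sigma>A) @ [t] \<in> sem_tr \<A> \<B> T S1"
    using seq_run.hyps(2) seq_run.prems(2) \<sigma>(2) by simp
  moreover have "s # s' # \<sigma> = (s # \<sigma>A) @ [t] @ \<sigma>B"
    by (simp add: \<sigma>(1))
  ultimately show ?case
    using \<sigma>(3) unfolding sem_tr_def sem_tr_env.simps chop_def by blast
next
  case (call m)
  then show ?case
    by (auto simp: sem_tr_Call sharp_def)
qed (auto simp: sem_tr_def restrict_tr_def sharp_def)

theorem mainTheorem1:
  fixes \<A> :: "('v, 'a) aeval"
    and \<B> :: "('v, 'b) beval"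
    and T :: "('v, 'a, 'b, 'p) table"
    and S :: "('v, 'a, 'b, 'p) stmt"
  assumes "wf_program S T"
  shows "sem_tr \<A> \<B> T S = sem_sos \<A> \<B> T S"
  unfolding sem_sos_eq_sos_run
proof (intro equalityI subsetI)
  fix \<sigma>
  assume "\<sigma> \<in> sem_tr \<A> \<B> T S"
  \<comment> \<open>Monotonicity in the environment passes from \<open>proc_env\<close> to the SOS
    runs of calls.\<close>
  then show "\<sigma> \<in> {ss. sos_run \<A> \<B> T S ss}"
    using sem_tr_env_mono[OF proc_env_subset_sos_run] sem_tr_env_sos_run_subset
    unfolding sem_tr_def by blast
next
  have "distinct (map fst T)"
    using assms by (simp add: wf_program_def wf_table_def)
  fix \<sigma>
  assume "\<sigma> \<in> {ss. sos_run \<A> \<B> T S ss}"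
  then have "sos_run \<A> \<B> T S \<sigma>"
    by simp
  then show "\<sigma> \<in> sem_tr \<A> \<B> T S"
    by induction (use \<open>distinct (map fst T)\<close> in \<open>auto intro: sem_tr_final_step sem_tr_run_step\<close>)
qed

end
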